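(* Let $X$ be a finite set and $W=\{0,1\}^X$. For every $Y\subseteq X$, \[e^\Sigma_Y=\bigwedge_{0\leq k<|Y|}e^\Sigma_{Y,k_\leq},\] where the meet is taken in the lattice $E(W)$ of equivalence relations on $W$.
   Context: $E(W)$ is the complete lattice of equivalence relations on $W$ ordered by inclusion; meets are intersections, and the empty meet is $W\times W$. For $w\in W$ and $Y\subseteq X$, the sum-score of $w$ on $Y$ is $w_Y:=\sum_{y\in Y}w_y$. The relation $e^\Sigma_Y$ is the equivalence relation on $W$ given by $(w,u)\in e^\Sigma_Y$ iff $w_Y=u_Y$. For $0\leq k<|Y|$, $e^\Sigma_{Y,k_\leq}$ is the equivalence relation on $W$ corresponding to the two-block partition $\{\{w\in W\mid w_Y\leq k\},\{w\in W\mid w_Y>k\}\}$. *)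

theory Defs
  imports "HOL-Algebra.Complete_Lattice" "HOL-Library.FuncSet"
begin

text \<open>
  The set $\{0,1\}^X$. The scores are natural numbers, so that sum-scores are ordinary sums;
  extensionality outside \<open>X\<close> makes equality of elements agree with equality of functions on \<open>X\<close>.
\<close>

definition responses :: "'a set \<Rightarrow> ('a \<Rightarrow> nat) set" where
  "responses X = (X \<rightarrow>\<^sub>E {0, 1})"

definition equiv_lattice :: "'b set \<Rightarrow> ('b \<times> 'b) set gorder" where
  "equiv_lattice W = \<lparr>carrier = {r. equiv W r}, eq = (=), le = (\<subseteq>)\<rparr>"

definition equiv_of_partition :: "'b set set \<Rightarrow> ('b \<times> 'b) set" where
  "equiv_of_partition P = {(w, u). \<exists>B\<in>P. w \<in> B \<and> u \<in> B}"

definition sum_score :: "('a \<Rightarrow> nat) \<Rightarrow> 'a set \<Rightarrow> nat" where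
  "sum_score w Y = (\<Sum>y\<in>Y. w y)"

definition sum_equiv :: "'a set \<Rightarrow> 'a set \<Rightarrow> (('a \<Rightarrow> nat) \<times> ('a \<Rightarrow> nat)) set" where
  "sum_equiv X Y =
     {(w, u). w \<in> responses X \<and> u \<in> responses X \<and> sum_score w Y = sum_score u Y}"

definition threshold_equiv ::
    "'a set \<Rightarrow> 'a set \<Rightarrow> nat \<Rightarrow> (('a \<Rightarrow> nat) \<times> ('a \<Rightarrow> nat)) set" where
  "threshold_equiv X Y k = equiv_of_partition
     {{w \<in> responses X. sum_score w Y \<le> k}, {w \<in> responses X. sum_score w Y > k}}"

text \<open>
  Since \<open>\<Sqinter>\<close> is defined by choice, the next lemmas show that it denotes the actual infimum:
  intersection, with \<open>W \<times> W\<close> as the empty meet.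
\<close>

lemma equiv_lattice_greatest:
  assumes "R \<subseteq> carrier (equiv_lattice W)"
  shows "greatest (equiv_lattice W) (W \<times> W \<inter> \<Inter>R) (Lower (equiv_lattice W) R)"
proof -
  have R: "equiv W r" if "r \<in> R" for r
    using assms that by (auto simp: equiv_lattice_def)
  have "equiv W (W \<times> W \<inter> \<Inter>R)"
  proof (rule equivI)
    show "refl_on W (W \<times> W \<inter> \<Inter>R)"
      using R by (auto simp: equiv_def refl_on_def)
    show "sym (W \<times> W \<inter> \<Inter>R)"
      using R by (auto simp: equiv_def sym_def)
    show "trans (W \<times> W \<inter> \<Inter>R)"
    proof (rule transI)
      fix x y z
      assume xy: "(x, y) \<in> W \<times> W \<inter> \<Inter>R" and yz: "(y, z) \<in> W \<times> W \<inter> \<Inter>R"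
      have "(x, z) \<in> r" if "r \<in> R" for r
        using R[OF that] xy yz that by (meson IntD2 InterE equivE transD)
      then show "(x, z) \<in> W \<times> W \<inter> \<Inter>R"
        using xy yz by blast
    qed
  qed simp
  moreover have "s \<subseteq> W \<times> W" if "equiv W s" for s
    using that by (rule equivE)
  ultimately show ?thesis
    using R unfolding greatest_def Lower_def equiv_lattice_def by auto
qed

lemma partial_order_equiv_lattice: "partial_order (equiv_lattice W)"
  by standard (auto simp: equiv_lattice_def)

lemma equiv_lattice_meet:
  assumes "R \<subseteq> carrier (equiv_lattice W)"
  shows "\<Sqinter>\<^bsub>equiv_lattice W\<^esub> R = W \<times> W \<inter> \<Inter>R"
proof -
  interpret partial_order "equiv_lattice W"
    by (rule partial_order_equiv_lattice)
  have "greatest (equiv_lattice W) (\<Sqinter>\<^bsub>equiv_lattice W\<^esub> R) (Lower (equiv_lattice W) R)"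
    unfolding inf_def using equiv_lattice_greatest[OF assms] by (rule someI)
  then show ?thesis
    using equiv_lattice_greatest[OF assms] greatest_unique by blast
qed

lemma complete_lattice_equiv_lattice: "complete_lattice (equiv_lattice W)"
proof -
  interpret partial_order "equiv_lattice W"
    by (rule partial_order_equiv_lattice)
  have "greatest (equiv_lattice W) (W \<times> W) (carrier (equiv_lattice W))"
    using equiv_lattice_greatest[of "{}" W] by (simp add: Lower_def)
  then show ?thesis
    by (rule complete_lattice_criterion1[OF exI]) (blast intro: equiv_lattice_greatest)
qed

end

theory Submission
  imports Defs
begin

text \<open>Meets in the lattice are intersections, so the meet relates two patterns exactly when no
  threshold \<open>k < card Y\<close> separates their scores. Equal scores are never separated. Of
  two distinct scores, the smaller is a threshold that separates them, and it is in range because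
  the larger is at most \<open>card Y\<close>.\<close>

lemma threshold_equiv_iff:
  "(w, u) \<in> threshold_equiv X Y k \<longleftrightarrow>
    w \<in> responses X \<and> u \<in> responses X \<and> (sum_score w Y \<le> k \<longleftrightarrow> sum_score u Y \<le> k)"
  by (auto simp: threshold_equiv_def equiv_of_partition_def)

lemma equiv_threshold_equiv: "equiv (responses X) (threshold_equiv X Y k)"
  by (rule equivI) (auto simp: refl_on_def sym_def trans_def threshold_equiv_iff)

text \<open>This bound is why thresholds below \<open>card Y\<close> suffice.\<close>

lemma sum_score_le_card:
  assumes "w \<in> responses X" and "Y \<subseteq> X"
  shows "sum_score w Y \<le> card Y"
proof -
  have "w y \<le> 1" if "y \<in> Y" for y
    using PiE_mem[OF assms(1)[unfolded responses_def], of y] assms(2) that by fastforce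
  then show ?thesis
    using sum_bounded_above[of Y w 1] by (simp add: sum_score_def)
qed

theorem lemma16:
  fixes X Y :: "'a set"
  assumes "finite X" and "Y \<subseteq> X"
  shows "sum_equiv X Y =
    \<Sqinter>\<^bsub>equiv_lattice (responses X)\<^esub> (threshold_equiv X Y ` {k. 0 \<le> k \<and> k < card Y})"
proof -
  let ?W = "responses X" and ?K = "{k. 0 \<le> k \<and> k < card Y}"
  have separate: "sum_score w Y = sum_score u Y"
    if W: "w \<in> ?W" "u \<in> ?W"
      and same: "\<forall>k<card Y. sum_score w Y \<le> k \<longleftrightarrow> sum_score u Y \<le> k" for w u
  proof (rule ccontr)
    assume neq: "sum_score w Y \<noteq> sum_score u Y"
    \<comment> \<open>The smaller of two distinct scores is itself a separating threshold.\<close>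
    define k where "k = min (sum_score w Y) (sum_score u Y)"
    \<comment> \<open>Strict because \<open>k\<close> lies below the larger score, itself at most
      \<open>card Y\<close>.\<close>
    have "k < card Y"
      using neq sum_score_le_card[OF W(1) assms(2)] sum_score_le_card[OF W(2) assms(2)]
      by (auto simp: k_def)
    then have "sum_score w Y \<le> k \<longleftrightarrow> sum_score u Y \<le> k"
      using same by blast
    then show False
      using neq by (auto simp: k_def min_def split: if_splits)
  qed
  have "\<Sqinter>\<^bsub>equiv_lattice ?W\<^esub> (threshold_equiv X Y ` ?K) =
      ?W \<times> ?W \<inter> \<Inter>(threshold_equiv X Y ` ?K)"
    by (rule equiv_lattice_meet) (auto simp: equiv_lattice_def equiv_threshold_equiv)
  \<comment> \<open>If \<open>card Y = 0\<close>, the family is empty and the factor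
    \<open>?W \<times> ?W\<close> alone gives the meet; all scores are then 0.\<close>
  also have "\<dots> = sum_equiv X Y"
    using separate by (auto simp: sum_equiv_def threshold_equiv_iff)
  finally show ?thesis ..
qed

end
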